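(* Let $G=(V,E)$ be a finite graph with symmetric positive edge weights $w_{xy}=w_{yx}>0$ and a finite measure $\mu:V\to(0,\infty)$, let $\Delta$ be the associated $\mu$-Laplacian, let $c$ be a negative constant, let $m$ be a positive integer, and let $h:V\to\mathbb{R}$ be a function such that $h(x)<0$ for all $x\in V$. Then the equation $$\Delta^{m} u=c-he^{u}\quad\text{in } V$$ has a solution $u:V\to\mathbb{R}$.
   Context: For $u:V\to\mathbb{R}$, the $\mu$-Laplacian is $\Delta u(x)=\frac{1}{\mu(x)}\sum_{y\sim x}w_{xy}(u(y)-u(x))$, where $y\sim x$ means $xy\in E$, and $\Delta^m$ is its $m$-fold iterate. *)

theory Defs
  imports Complex_Main
begin

text \<open>
  Edges are unordered pairs of vertices. Loops are not excluded: they contribute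
  nothing to the Laplacian. The weight function is constrained on edges only.
\<close>

locale finite_weighted_graph =
  fixes V :: "'a set" and E :: "'a set set"
    and w :: "'a \<Rightarrow> 'a \<Rightarrow> real" and \<mu> :: "'a \<Rightarrow> real"
  assumes finite_vertices: "finite V"
    and edges: "\<And>e. e \<in> E \<Longrightarrow> \<exists>x\<in>V. \<exists>y\<in>V. e = {x, y}"
    and weight_sym: "\<And>x y. {x, y} \<in> E \<Longrightarrow> w x y = w y x"
    and weight_pos: "\<And>x y. {x, y} \<in> E \<Longrightarrow> w x y > 0"
    and measure_pos: "\<And>x. x \<in> V \<Longrightarrow> \<mu> x > 0"

text \<open>
  In a finite weighted graph every neighbour lies in \<open>V\<close>, so the sum is finite and
  the values on \<open>V\<close> of the Laplacian and of its iterates depend only on the values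
  of the argument on \<open>V\<close>.
\<close>

definition laplacian ::
  "'a set set \<Rightarrow> ('a \<Rightarrow> 'a \<Rightarrow> real) \<Rightarrow> ('a \<Rightarrow> real) \<Rightarrow> ('a \<Rightarrow> real) \<Rightarrow> 'a \<Rightarrow> real"
  where "laplacian E w \<mu> u x = (1 / \<mu> x) * (\<Sum>y | {x, y} \<in> E. w x y * (u y - u x))"

end

theory Submission
  imports Defs "HOL-Analysis.Analysis"
begin

text \<open>
  Put \<open>b = - c > 0\<close>, \<open>k = - h > 0\<close>, \<open>T = \<Delta>\<^sup>m\<close> and \<open>s = (-1)\<^sup>m\<close>, so that \<open>T u = k e\<^sup>u - b\<close> has to
  be solved. Components of the graph can be treated separately. On a connected one, with total
  measure \<open>M\<close>, the functional
  \<open>F v = s/2 \<integral> v T v - s b (M ln (\<integral> k e\<^sup>v) - \<integral> v)\<close>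
  is invariant under adding constants. Its quadratic part is positive definite modulo constants,
  and the remaining part grows at most linearly, so \<open>F\<close> attains a minimum whatever the sign
  of \<open>s\<close>. A minimiser \<open>v\<close> satisfies \<open>T v = b M k e\<^sup>v / (\<integral> k e\<^sup>v) - b\<close>, and adding the
  constant \<open>ln (b M / \<integral> k e\<^sup>v)\<close> gives a solution.
\<close>

section \<open>Minimisation over finitely supported functions\<close>

lemma continuous_on_coordinate [continuous_intros]:
  "continuous_on A (\<lambda>v :: 'a \<Rightarrow> 'b::topological_space. v x)"
  by (rule continuous_on_subset[OF continuous_on_product_coordinates]) simp

text \<open>Functions on \<open>U\<close> are represented by total functions vanishing off
  \<open>U\<close>, so that the product topology on the full function type can be used.\<close>

definition supported_on :: "'a set \<Rightarrow> ('a \<Rightarrow> real) set"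
  where "supported_on U = {v. \<forall>x. x \<notin> U \<longrightarrow> v x = 0}"

text \<open>Tychonoff: the box is a product of compact intervals over \<open>U\<close> and
  singletons \<open>{0}\<close> elsewhere.\<close>

lemma compact_supported_box:
  "compact {v \<in> supported_on U. \<forall>x\<in>U. \<bar>v x\<bar> \<le> R}"
proof -
  have "compactin (product_topology (\<lambda>_. euclidean) UNIV)
      (\<Pi>\<^sub>E x\<in>UNIV. if x \<in> U then {-R..R} else {0::real})"
    by (subst compactin_PiE) auto
  moreover have "(\<Pi>\<^sub>E x\<in>UNIV. if x \<in> U then {-R..R} else {0::real})
      = {v \<in> supported_on U. \<forall>x\<in>U. \<bar>v x\<bar> \<le> R}"
    by (auto simp: supported_on_def PiE_def Pi_def abs_le_iff split: if_splits)
  ultimately show ?thesis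
    by (simp add: euclidean_product_topology)
qed

lemma continuous_on_L2_set_coordinates:
  "continuous_on UNIV (\<lambda>v :: 'a \<Rightarrow> real. L2_set v U)"
  unfolding L2_set_def by (intro continuous_intros)

lemma abs_le_L2_set:
  assumes "finite U" "x \<in> U"
  shows "\<bar>v x\<bar> \<le> L2_set v U"
proof -
  have "\<bar>v x\<bar> \<le> L2_set (\<lambda>x. \<bar>v x\<bar>) U"
    using assms by (rule member_le_L2_set)
  then show ?thesis by (simp add: L2_set_def)
qed

text \<open>The minimum of \<open>Q\<close> on the compact unit sphere is positive; homogeneity of
  degree two carries the bound to all vectors.\<close>

lemma positive_form_coercive:
  fixes Q :: "('a \<Rightarrow> real) \<Rightarrow> real"
  assumes "finite U" and cont: "continuous_on UNIV Q"
    and hom: "\<And>t v. Q (\<lambda>x. t * v x) = t\<^sup>2 * Q v"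
    and pos: "\<And>v x. v \<in> supported_on U \<Longrightarrow> v x \<noteq> 0 \<Longrightarrow> Q v > 0"
  obtains l where "l > 0" "\<And>v. v \<in> supported_on U \<Longrightarrow> l * (L2_set v U)\<^sup>2 \<le> Q v"
proof -
  define K where "K = {v \<in> supported_on U. \<forall>x\<in>U. \<bar>v x\<bar> \<le> 1} \<inter> {v. L2_set v U = 1}"
  have "closed {v :: 'a \<Rightarrow> real. L2_set v U = 1}"
    by (intro closed_Collect_eq continuous_on_L2_set_coordinates continuous_on_const)
  then have "compact K"
    unfolding K_def by (intro compact_Int_closed compact_supported_box)
  have K_I: "v \<in> K" if "v \<in> supported_on U" "L2_set v U = 1" for v
    using that abs_le_L2_set[OF \<open>finite U\<close>, of _ v] by (auto simp: K_def)
  obtain l where l: "l > 0" "\<And>v. v \<in> K \<Longrightarrow> l \<le> Q v"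
  proof (cases "K = {}")
    \<comment> \<open>The sphere is empty exactly when \<open>U\<close> is, so the value 1 is
      arbitrary.\<close>
    case True
    then show ?thesis using that[of 1] by simp
  next
    case False
    obtain v where v: "v \<in> K" "\<And>w. w \<in> K \<Longrightarrow> Q v \<le> Q w"
      using continuous_attains_inf[OF \<open>compact K\<close> False continuous_on_subset[OF cont]] by auto
    have "\<exists>x. v x \<noteq> 0"
    proof (rule ccontr)
      assume "\<not> ?thesis"
      then have "L2_set v U = 0" by (simp add: L2_set_def)
      then show False using v(1) by (simp add: K_def)
    qed
    then have "Q v > 0" using pos v(1) by (auto simp: K_def)
    then show ?thesis using that v(2) by blast
  qed
  have "l * (L2_set v U)\<^sup>2 \<le> Q v" if v: "v \<in> supported_on U" for v
  proof (cases "L2_set v U = 0")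
    case True
    have "Q v \<ge> 0"
    proof (cases "\<exists>x. v x \<noteq> 0")
      case True
      then show ?thesis using pos v by (auto intro: less_imp_le)
    next
      case False
      then have "v = (\<lambda>x. 0 * v x)" by auto
      then have "Q v = 0" using hom[of 0 v] by simp
      then show ?thesis by simp
    qed
    then show ?thesis using True by simp
  next
    case False
    define N where "N = L2_set v U"
    have N: "N > 0" using False L2_set_nonneg[of v U] by (simp add: N_def less_le)
    have "L2_set (\<lambda>x. (1 / N) * v x) U = 1"
      using L2_set_right_distrib[of "1 / N" v U] N by (simp add: N_def)
    moreover have "(\<lambda>x. (1 / N) * v x) \<in> supported_on U"
      using v by (simp add: supported_on_def)
    ultimately have "l \<le> Q (\<lambda>x. (1 / N) * v x)" using K_I l(2) by blast
    then have "l \<le> Q v / N\<^sup>2" unfolding hom by (simp add: power_divide)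
    then show ?thesis using N by (simp add: N_def[symmetric] field_simps)
  qed
  then show ?thesis using that l(1) by blast
qed

text \<open>Outside the box of radius \<open>B / l\<close> the quadratic term dominates the linear
  one, so \<open>F\<close> is at least its value at 0 there. A minimum over the compact box, which
  contains 0, is therefore global.\<close>

lemma quadratic_growth_attains_min:
  fixes F :: "('a \<Rightarrow> real) \<Rightarrow> real"
  assumes "finite U" and cont: "continuous_on UNIV F" and "l > 0" "B \<ge> 0"
    and grow: "\<And>v. v \<in> supported_on U \<Longrightarrow> F (\<lambda>_. 0) + l * (L2_set v U)\<^sup>2 - B * L2_set v U \<le> F v"
  obtains v where "v \<in> supported_on U" "\<And>w. w \<in> supported_on U \<Longrightarrow> F v \<le> F w"
proof -
  define R where "R = B / l"
  define K where "K = {v \<in> supported_on U. \<forall>x\<in>U. \<bar>v x\<bar> \<le> R}"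
  have z: "(\<lambda>_. 0) \<in> K" using assms by (simp add: K_def R_def supported_on_def)
  obtain v where v: "v \<in> K" "\<And>w. w \<in> K \<Longrightarrow> F v \<le> F w"
    using continuous_attains_inf[OF _ _ continuous_on_subset[OF cont], of K] z
      compact_supported_box[of U R] unfolding K_def by blast
  have "F v \<le> F w" if w: "w \<in> supported_on U" for w
  proof (cases "w \<in> K")
    case True
    then show ?thesis by (rule v(2))
  next
    case False
    then obtain x where "x \<in> U" "\<bar>w x\<bar> > R" using w by (auto simp: K_def)
    then have "L2_set w U > R" using abs_le_L2_set[OF \<open>finite U\<close>, of x w] by simp
    then have "l * L2_set w U \<ge> B" using \<open>l > 0\<close> by (simp add: R_def field_simps)
    then have "l * (L2_set w U)\<^sup>2 \<ge> B * L2_set w U"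
      using mult_right_mono[OF _ L2_set_nonneg[of w U]] by (fastforce simp: power2_eq_square)
    then have "F (\<lambda>_. 0) \<le> F w" using grow[OF w] by linarith
    then show ?thesis using v(2)[OF z] by linarith
  qed
  then show ?thesis using that v(1) unfolding K_def by blast
qed

section \<open>Mean-field equations for symmetric operators\<close>

text \<open>The exponential sum lies between \<open>exp (- r)\<close> and \<open>exp r\<close> times
  the sum of the \<open>a x\<close>. This gives the linear growth of the logarithmic term.\<close>

lemma abs_ln_sum_exp_diff_le:
  fixes a v :: "'a \<Rightarrow> real"
  assumes "finite V" "V \<noteq> {}" and a: "\<And>x. x \<in> V \<Longrightarrow> a x > 0"
    and v: "\<And>x. x \<in> V \<Longrightarrow> \<bar>v x\<bar> \<le> r"
  shows "\<bar>ln (\<Sum>x\<in>V. a x * exp (v x)) - ln (\<Sum>x\<in>V. a x)\<bar> \<le> r"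
proof -
  let ?Z = "\<Sum>x\<in>V. a x * exp (v x)" and ?A = "\<Sum>x\<in>V. a x"
  have Z: "?Z > 0" and A: "?A > 0" using assms by (auto intro!: sum_pos)
  have "?Z \<le> ?A * exp r" unfolding sum_distrib_right
    using a v by (intro sum_mono mult_left_mono) (auto simp: abs_le_iff less_imp_le)
  moreover have "?A * exp (- r) \<le> ?Z" unfolding sum_distrib_right
    using a v by (intro sum_mono mult_left_mono) (force simp: abs_le_iff less_imp_le)+
  ultimately have "ln ?Z \<le> ln (?A * exp r)" "ln (?A * exp (- r)) \<le> ln ?Z"
    using Z A by simp_all
  then show ?thesis using A by (simp add: ln_mult)
qed

text \<open>The variational argument for an abstract operator \<open>T\<close> that is symmetric,
  kills constants and is definite modulo constants; \<open>s\<close> is the sign that makes its form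
  positive.\<close>

lemma symmetric_mean_field_solution:
  fixes T :: "('a \<Rightarrow> real) \<Rightarrow> 'a \<Rightarrow> real" and s b :: real
  assumes V: "finite V" "p \<in> V"
    and mu: "\<And>x. x \<in> V \<Longrightarrow> \<mu> x > 0" and k: "\<And>x. x \<in> V \<Longrightarrow> k x > 0"
    and b: "b > 0" and s: "s * s = 1"
    and cont: "\<And>x. continuous_on UNIV (\<lambda>v. T v x)"
    and lin: "\<And>f g t x. T (\<lambda>x. f x + t * g x) x = T f x + t * T g x"
    and const: "\<And>x. T (\<lambda>_. 1) x = 0"
    and sym: "\<And>f g. (\<Sum>x\<in>V. \<mu> x * T f x * g x) = (\<Sum>x\<in>V. \<mu> x * f x * T g x)"
    and pos: "\<And>v x. x \<in> V \<Longrightarrow> v x \<noteq> v p \<Longrightarrow> s * (\<Sum>x\<in>V. \<mu> x * T v x * v x) > 0"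
  shows "\<exists>u. \<forall>x\<in>V. T u x = k x * exp (u x) - b"
proof -
  \<comment> \<open>Pinning the value 0 at \<open>p\<close> selects one representative of each class
    modulo constants, which makes the form definite.\<close>
  define U where "U = V - {p}"
  define M where "M = (\<Sum>x\<in>V. \<mu> x)"
  define Z where "Z v = (\<Sum>x\<in>V. \<mu> x * k x * exp (v x))" for v
  define Q where "Q v = s * (\<Sum>x\<in>V. \<mu> x * T v x * v x)" for v
  define F where "F v = Q v / 2 - s * b * (M * ln (Z v) - (\<Sum>x\<in>V. \<mu> x * v x))" for v
  have U: "finite U" using V by (simp add: U_def)
  have M: "M > 0" unfolding M_def using V mu by (intro sum_pos) auto
  have Z: "Z v > 0" for v unfolding Z_def using V mu k by (intro sum_pos) auto
  have abs_s: "\<bar>s\<bar> = 1"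
    using s by (auto simp: square_eq_1_iff)
  have T0: "T (\<lambda>_. 0) x = 0" for x using lin[of "\<lambda>_. 1" "-1" "\<lambda>_. 1"] const by simp
  have T_scale: "T (\<lambda>x. t * f x) x = t * T f x" for t f x
    using lin[of "\<lambda>_. 0" t f x] T0 by simp
  have Q_cont: "continuous_on UNIV Q"
    unfolding Q_def by (intro continuous_intros cont)
  have F_cont: "continuous_on UNIV F"
    unfolding F_def Z_def using Z[unfolded Z_def]
    by (intro continuous_intros Q_cont) (auto simp: Z_def less_imp_neq[THEN not_sym])
  have Q_hom: "Q (\<lambda>x. t * v x) = t\<^sup>2 * Q v" for t v
    unfolding Q_def T_scale by (simp add: sum_distrib_left power2_eq_square mult_ac)
  have Q_pos: "Q v > 0" if "v \<in> supported_on U" "v x \<noteq> 0" for v x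
    using that pos[of x v] by (force simp: supported_on_def U_def Q_def)
  obtain l where
    l: "l > 0" "\<And>v. v \<in> supported_on U \<Longrightarrow> l * (L2_set v U)\<^sup>2 \<le> Q v"
    by (rule positive_form_coercive[OF U Q_cont Q_hom Q_pos]) auto
  \<comment> \<open>The logarithmic and the integral term each vary by at most \<open>M\<close>
    times the norm, whence the factor \<open>2 * b * M\<close>.\<close>
  have "F (\<lambda>_. 0) + l / 2 * (L2_set v U)\<^sup>2 - 2 * b * M * L2_set v U \<le> F v"
    if v: "v \<in> supported_on U" for v
  proof -
    let ?n = "L2_set v U"
    have vx: "\<bar>v x\<bar> \<le> ?n" if "x \<in> V" for x
    proof (cases "x \<in> U")
      case True
      then show ?thesis by (rule abs_le_L2_set[OF U])
    next
      case False
      then show ?thesis using v by (simp add: supported_on_def)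
    qed
    have "\<bar>ln (Z v) - ln (Z (\<lambda>_. 0))\<bar> \<le> ?n"
      using abs_ln_sum_exp_diff_le[of V "\<lambda>x. \<mu> x * k x" v ?n] V mu k vx by (auto simp: Z_def)
    then have "\<bar>M * (ln (Z v) - ln (Z (\<lambda>_. 0)))\<bar> \<le> M * ?n"
      using M by (simp add: abs_mult)
    moreover have "\<bar>\<Sum>x\<in>V. \<mu> x * v x\<bar> \<le> M * ?n"
      unfolding M_def sum_distrib_right using mu vx
      by (intro order_trans[OF sum_abs] sum_mono) (simp add: abs_mult abs_of_pos)
    ultimately have
      "\<bar>M * (ln (Z v) - ln (Z (\<lambda>_. 0))) - (\<Sum>x\<in>V. \<mu> x * v x)\<bar> \<le> 2 * M * ?n" by linarith
    then have "\<bar>s * b * (M * (ln (Z v) - ln (Z (\<lambda>_. 0))) - (\<Sum>x\<in>V. \<mu> x * v x))\<bar>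
        \<le> b * (2 * M * ?n)"
      unfolding abs_mult abs_s using b by simp
    moreover have "F v - F (\<lambda>_. 0)
        = Q v / 2 - s * b * (M * (ln (Z v) - ln (Z (\<lambda>_. 0))) - (\<Sum>x\<in>V. \<mu> x * v x))"
      by (simp add: F_def Q_def T0 algebra_simps)
    ultimately show ?thesis using l(2)[OF v] by (simp add: algebra_simps abs_le_iff)
  qed
  then obtain v where v: "v \<in> supported_on U" "\<And>w. w \<in> supported_on U \<Longrightarrow> F v \<le> F w"
    using quadratic_growth_attains_min[OF U F_cont, of "l / 2" "2 * b * M"] l(1) b M by auto
  \<comment> \<open>The residual of the Euler-Lagrange equation of \<open>F\<close>.\<close>
  define r where "r x = T v x - (b * M * k x * exp (v x) / Z v - b)" for x
  have crit: "r x = 0" if x: "x \<in> U" for x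
  proof -
    \<comment> \<open>Variation in the single coordinate \<open>x\<close>; since \<open>x\<close>
      differs from \<open>p\<close>, the perturbed function stays admissible.\<close>
    define e where "e y = (if y = x then 1 else 0 :: real)" for y
    define \<phi> where "\<phi> t = F (\<lambda>y. v y + t * e y)" for t
    have xV: "x \<in> V" using x by (simp add: U_def)
    have Te: "(\<Sum>y\<in>V. g y * e y) = g x" for g
      using V xV by (simp add: e_def if_distrib cong: if_cong)
    have Q_exp: "Q (\<lambda>y. v y + t * e y) = Q v + t * (2 * s * \<mu> x * T v x) + t\<^sup>2 * Q e" for t
    proof -
      have "(\<Sum>y\<in>V. \<mu> y * T e y * v y) = \<mu> x * T v x"
        using sym[of v e] Te[of "\<lambda>y. \<mu> y * T v y"] by (simp add: mult_ac)
      moreover have "(\<Sum>y\<in>V. \<mu> y * T v y * e y) = \<mu> x * T v x"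
        by (rule Te)
      moreover have "(\<Sum>y\<in>V. \<mu> y * T (\<lambda>y. v y + t * e y) y * (v y + t * e y))
        = (\<Sum>y\<in>V. \<mu> y * T v y * v y) + t * (\<Sum>y\<in>V. \<mu> y * T v y * e y)
          + t * (\<Sum>y\<in>V. \<mu> y * T e y * v y) + t\<^sup>2 * (\<Sum>y\<in>V. \<mu> y * T e y * e y)"
        unfolding lin sum_distrib_left sum.distrib[symmetric]
        by (intro sum.cong) (auto simp: algebra_simps power2_eq_square)
      ultimately show ?thesis by (simp add: Q_def algebra_simps)
    qed
    have Z_der: "((\<lambda>t. Z (\<lambda>y. v y + t * e y)) has_real_derivative \<mu> x * k x * exp (v x)) (at 0)"
    proof -
      have "((\<lambda>t. Z (\<lambda>y. v y + t * e y)) has_real_derivative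
          (\<Sum>y\<in>V. \<mu> y * k y * exp (v y) * e y)) (at 0)"
        unfolding Z_def by (auto intro!: derivative_eq_intros sum.cong)
      then show ?thesis unfolding Te .
    qed
    have lin_part: "(\<Sum>y\<in>V. \<mu> y * (v y + t * e y)) = (\<Sum>y\<in>V. \<mu> y * v y) + t * \<mu> x" for t
      using Te[of "\<lambda>y. \<mu> y"] by (simp add: algebra_simps sum.distrib sum_distrib_left[symmetric])
    have "(\<phi> has_real_derivative
        s * \<mu> x * T v x - s * b * (M * (\<mu> x * k x * exp (v x) / Z v) - \<mu> x)) (at 0)"
      unfolding \<phi>_def F_def Q_exp lin_part
      using Z by (auto intro!: derivative_eq_intros Z_der simp: field_simps)
    moreover have "\<phi> 0 \<le> \<phi> t" for t
    proof -
      have "(\<lambda>y. v y + t * e y) \<in> supported_on U"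
        using v(1) x by (auto simp: supported_on_def e_def)
      then show ?thesis using v(2) by (simp add: \<phi>_def)
    qed
    ultimately have "s * \<mu> x * T v x - s * b * (M * (\<mu> x * k x * exp (v x) / Z v) - \<mu> x) = 0"
      by (intro DERIV_local_min[of \<phi> _ 0 1]) auto
    \<comment> \<open>The derivative of \<open>\<phi>\<close> at 0 is the residual times
      \<open>s * \<mu> x\<close>, a nonzero factor because \<open>s * s = 1\<close>.\<close>
    then have "s * \<mu> x * r x = 0" by (simp add: r_def algebra_simps)
    then show ?thesis using s mu[OF xV] by auto
  qed
  \<comment> \<open>The minimiser is pinned at the base point; the equation there follows by integration.\<close>
  have "(\<Sum>x\<in>V. \<mu> x * r x) = (\<Sum>x\<in>V. \<mu> x * T v x * 1) - (b * M / Z v * Z v - b * M)"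
    unfolding r_def Z_def[of v] M_def[symmetric] sum_distrib_left
    by (simp add: algebra_simps sum.distrib sum_subtractf M_def sum_distrib_left sum_divide_distrib)
  also have "\<dots> = 0" using sym[of v "\<lambda>_. 1"] const Z[of v] by simp
  finally have "(\<Sum>x\<in>V. \<mu> x * r x) = 0" .
  then have "\<mu> p * r p + (\<Sum>x\<in>U. \<mu> x * r x) = 0"
    using V by (simp add: U_def sum.remove)
  then have "r p = 0" using crit mu[OF V(2)] by simp
  then have r: "r x = 0" if "x \<in> V" for x using crit that by (auto simp: U_def)
  \<comment> \<open>The shift leaves \<open>T v\<close> unchanged and multiplies the exponential by
    \<open>b * M / Z v\<close>, absorbing the normalisation.\<close>
  have "T (\<lambda>y. v y + ln (b * M / Z v)) x = k x * exp (v x + ln (b * M / Z v)) - b"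
    if "x \<in> V" for x
    using r[OF that] lin[of v "ln (b * M / Z v)" "\<lambda>_. 1" x] const b M Z[of v]
    by (simp add: r_def exp_add field_simps)
  then show ?thesis by blast
qed

section \<open>Powers of the Laplacian\<close>

lemma laplacian_pow_continuous:
  "continuous_on UNIV (\<lambda>v. (laplacian E w \<mu> ^^ m) v x)"
proof (induction m arbitrary: x)
  case (Suc m)
  then show ?case
    unfolding funpow.simps comp_apply laplacian_def[of E w \<mu> "(_ ^^ _) _"]
    by (intro continuous_on_mult continuous_on_sum continuous_on_diff continuous_on_const)
qed (simp add: continuous_on_coordinate)

lemma laplacian_pow_linear:
  "(laplacian E w \<mu> ^^ m) (\<lambda>x. f x + t * g x)
    = (\<lambda>x. (laplacian E w \<mu> ^^ m) f x + t * (laplacian E w \<mu> ^^ m) g x)"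
proof (induction m)
  case (Suc m)
  have "laplacian E w \<mu> (\<lambda>x. f x + t * g x) x = laplacian E w \<mu> f x + t * laplacian E w \<mu> g x"
    for f g x
    unfolding laplacian_def
    by (simp add: sum_distrib_left sum.distrib[symmetric] algebra_simps)
  then show ?case by (simp add: Suc)
qed simp

lemma laplacian_pow_const:
  assumes "m > 0"
  shows "(laplacian E w \<mu> ^^ m) (\<lambda>_. a) x = 0"
proof -
  have "(laplacian E w \<mu> ^^ Suc n) (\<lambda>_. a) = (\<lambda>_. 0)" for n
    by (induction n) (auto simp: laplacian_def[abs_def])
  from this[of "m - 1"] show ?thesis using assms by simp
qed

text \<open>Locality: when no edge leaves \<open>C\<close>, iterates at points of \<open>C\<close>
  see only edges and values in \<open>C\<close>. This permits gluing solutions found on separate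
  components.\<close>

lemma laplacian_pow_cong:
  assumes edges: "\<And>x y. x \<in> C \<Longrightarrow> {x, y} \<in> E \<longleftrightarrow> {x, y} \<in> E'"
    and closed: "\<And>x y. x \<in> C \<Longrightarrow> {x, y} \<in> E \<Longrightarrow> y \<in> C"
    and eq: "\<And>x. x \<in> C \<Longrightarrow> f x = g x" and "x \<in> C"
  shows "(laplacian E w \<mu> ^^ m) f x = (laplacian E' w \<mu> ^^ m) g x"
  using \<open>x \<in> C\<close>
proof (induction m arbitrary: x)
  case (Suc m)
  then show ?case
    using edges closed by (auto simp: laplacian_def[of _ _ _ "(_ ^^ _) _"] intro!: sum.cong)
qed (simp add: eq)

section \<open>Green's formula, symmetry and sign of the Laplacian\<close>

context finite_weighted_graph
begin

abbreviation \<Delta> where "\<Delta> \<equiv> laplacian E w \<mu>"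

text \<open>Extension of \<open>w\<close> by zero to non-edges, so that neighbour sums become sums
  over all of \<open>V\<close> and can be interchanged.\<close>

definition weight where "weight x y = (if {x, y} \<in> E then w x y else 0)"

definition ip where "ip f g = (\<Sum>x\<in>V. \<mu> x * f x * g x)"

lemma edge_in: "{x, y} \<in> E \<Longrightarrow> y \<in> V"
  using edges by (fastforce simp: doubleton_eq_iff)

lemma weight_commute: "weight x y = weight y x"
  using weight_sym by (simp add: weight_def insert_commute)

lemma weight_nonneg: "weight x y \<ge> 0"
  using weight_pos by (simp add: weight_def less_imp_le)

lemma ip_commute: "ip f g = ip g f"
  by (simp add: ip_def mult_ac)

lemma ip_self_eq_0: "ip f f = 0 \<longleftrightarrow> (\<forall>x\<in>V. f x = 0)"
proof -
  have "\<mu> x * f x * f x \<ge> 0" if "x \<in> V" for x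
    using measure_pos[OF that] by (simp add: mult.assoc)
  then show ?thesis
    unfolding ip_def using measure_pos finite_vertices
    by (subst sum_nonneg_eq_0_iff) force+
qed

lemma ip_self_nonneg: "ip f f \<ge> 0"
  unfolding ip_def using measure_pos by (intro sum_nonneg) (simp add: mult.assoc less_imp_le)

lemma measure_laplacian:
  assumes "x \<in> V"
  shows "\<mu> x * \<Delta> f x = (\<Sum>y\<in>V. weight x y * (f y - f x))"
proof -
  have "(\<Sum>y\<in>V. weight x y * (f y - f x)) = (\<Sum>y | {x, y} \<in> E. w x y * (f y - f x))"
    using finite_vertices edge_in
    by (intro sum.mono_neutral_cong_right) (auto simp: weight_def)
  then show ?thesis using measure_pos[OF assms] by (simp add: laplacian_def)
qed

text \<open>Exchanging the two summation variables yields a second expression for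
  \<open>ip (\<Delta> f) g\<close>; adding both gives the Dirichlet form, where each non-loop edge
  occurs in both orientations.\<close>

lemma green_formula:
  "2 * ip (\<Delta> f) g = - (\<Sum>x\<in>V. \<Sum>y\<in>V. weight x y * (f y - f x) * (g y - g x))"
proof -
  have 1: "ip (\<Delta> f) g = (\<Sum>x\<in>V. \<Sum>y\<in>V. weight x y * (f y - f x) * g x)"
    by (simp add: ip_def measure_laplacian sum_distrib_right)
  also have "\<dots> = (\<Sum>x\<in>V. \<Sum>y\<in>V. weight x y * (f x - f y) * g y)"
    by (subst sum.swap) (simp add: weight_commute)
  finally have 2: "ip (\<Delta> f) g = (\<Sum>x\<in>V. \<Sum>y\<in>V. weight x y * (f x - f y) * g y)" .
  show ?thesis
    unfolding mult_2 by (subst (1) 1, subst 2)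
      (simp add: sum.distrib[symmetric] sum_negf[symmetric] algebra_simps)
qed

lemma laplacian_symmetric: "ip (\<Delta> f) g = ip f (\<Delta> g)"
  using green_formula[of f g] green_formula[of g f] by (simp add: ip_commute[of f] mult_ac)

lemma laplacian_pow_symmetric: "ip ((\<Delta> ^^ m) f) g = ip f ((\<Delta> ^^ m) g)"
proof (induction m arbitrary: g)
  case (Suc m)
  have "ip ((\<Delta> ^^ Suc m) f) g = ip f ((\<Delta> ^^ m) (\<Delta> g))"
    by (simp add: laplacian_symmetric Suc)
  then show ?case by (simp add: funpow_swap1)
qed simp

lemma laplacian_nonpos: "ip (\<Delta> f) f \<le> 0"
proof -
  have "0 \<le> (\<Sum>x\<in>V. \<Sum>y\<in>V. weight x y * (f y - f x) * (f y - f x))"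
    by (intro sum_nonneg) (simp add: mult.assoc weight_nonneg)
  then show ?thesis using green_formula[of f f] by linarith
qed

text \<open>The Dirichlet energy is a sum of nonnegative terms, so its vanishing forces every
  difference along an edge to vanish.\<close>

lemma laplacian_form_eq_0:
  assumes "ip (\<Delta> f) f = 0" and xy: "{x, y} \<in> E"
  shows "f x = f y"
proof -
  have "(\<Sum>x\<in>V. \<Sum>y\<in>V. weight x y * (f y - f x) * (f y - f x)) = 0"
    using green_formula[of f f] assms(1) by linarith
  moreover have "weight x y * (f y - f x) * (f y - f x) \<ge> 0" for x y
    by (simp add: mult.assoc weight_nonneg)
  ultimately have "\<forall>x\<in>V. \<forall>y\<in>V. weight x y * (f y - f x) * (f y - f x) = 0"
    using finite_vertices by (simp add: sum_nonneg_eq_0_iff sum_nonneg)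
  moreover have "x \<in> V" "y \<in> V" using edge_in xy by (auto simp: insert_commute)
  ultimately show ?thesis using weight_pos[OF xy] xy by (fastforce simp: weight_def)
qed

end

section \<open>Definiteness of the powers on a connected graph\<close>

text \<open>Connectedness is expressed by the edge-invariant functions being constant.\<close>

locale connected_weighted_graph = finite_weighted_graph +
  assumes connected: "\<And>f :: 'a \<Rightarrow> real. \<And>x y. (\<And>x y. {x, y} \<in> E \<Longrightarrow> f x = f y) \<Longrightarrow>
    x \<in> V \<Longrightarrow> y \<in> V \<Longrightarrow> f x = f y"
begin

text \<open>Induction on \<open>m\<close>: \<open>(\<Delta> ^^ m) f\<close> is harmonic, hence
  constant. For positive \<open>m\<close> it is also orthogonal to constants, hence zero, and the
  induction hypothesis applies.\<close>

lemma laplacian_pow_eq_0_imp_const: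
  assumes "\<forall>x\<in>V. (\<Delta> ^^ m) f x = 0" "x \<in> V" "y \<in> V"
  shows "f x = f y"
  using assms
proof (induction m arbitrary: x y)
  case (Suc m)
  let ?g = "(\<Delta> ^^ m) f"
  have g: "\<forall>x\<in>V. \<Delta> ?g x = 0" using Suc.prems(1) by simp
  then have "ip (\<Delta> ?g) ?g = 0" by (simp add: ip_def)
  then have const: "?g z = ?g x" if "z \<in> V" for z
    using connected[of ?g] laplacian_form_eq_0 that \<open>x \<in> V\<close> by blast
  show ?case
  proof (cases m)
    case 0
    then show ?thesis using const \<open>y \<in> V\<close> by simp
  next
    case (Suc n)
    have "ip ?g ?g = ?g x * ip ?g (\<lambda>_. 1)"
      unfolding ip_def sum_distrib_left by (intro sum.cong) (auto simp: const)
    \<comment> \<open>Symmetry moves the power onto the constant 1, which it kills because the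
      exponent is \<open>Suc n\<close>.\<close>
    also have "ip ?g (\<lambda>_. 1) = 0"
      unfolding laplacian_pow_symmetric by (simp add: ip_def laplacian_pow_const Suc del: funpow.simps)
    finally have "\<forall>x\<in>V. ?g x = 0" by (simp add: ip_self_eq_0)
    then show ?thesis using Suc.IH Suc.prems by blast
  qed
qed simp

text \<open>Half of the factors move across by symmetry: with \<open>g = (\<Delta> ^^ j) f\<close>
  the form is \<open>ip g g\<close> for \<open>m = 2 * j\<close> and
  \<open>ip (\<Delta> g) g\<close> for \<open>m = 2 * j + 1\<close>. Vanishing of either would make
  \<open>f\<close> constant.\<close>

lemma laplacian_pow_definite:
  assumes "x \<in> V" "y \<in> V" "f x \<noteq> f y"
  shows "(-1) ^ m * ip ((\<Delta> ^^ m) f) f > 0"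
proof -
  have pow_add: "ip ((\<Delta> ^^ (i + j)) f) f = ip ((\<Delta> ^^ i) f) ((\<Delta> ^^ j) f)" for i j
    by (simp add: add.commute[of i] funpow_add laplacian_pow_symmetric[of j "(\<Delta> ^^ i) f"])
  show ?thesis
  proof (cases "even m")
    case True
    then obtain j where j: "m = j + j" by (auto simp: dvd_def mult_2)
    have "ip ((\<Delta> ^^ j) f) ((\<Delta> ^^ j) f) \<noteq> 0"
      using laplacian_pow_eq_0_imp_const[of j f x y] assms by (auto simp: ip_self_eq_0)
    then show ?thesis
      using ip_self_nonneg[of "(\<Delta> ^^ j) f"] True by (simp add: j pow_add)
  next
    case False
    then obtain j where j: "m = Suc j + j" by (auto elim!: oddE simp: mult_2)
    let ?g = "(\<Delta> ^^ j) f"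
    have "ip (\<Delta> ?g) ?g \<noteq> 0"
    proof
      assume "ip (\<Delta> ?g) ?g = 0"
      then have const: "?g z = ?g x" if "z \<in> V" for z
        using connected[of ?g] laplacian_form_eq_0 that \<open>x \<in> V\<close> by blast
      have "\<Delta> ?g z = 0" if "z \<in> V" for z
      proof -
        have "\<mu> z * \<Delta> ?g z = 0"
          unfolding measure_laplacian[OF that] by (simp add: const that)
        then show ?thesis using measure_pos[OF that] by simp
      qed
      then show False
        using laplacian_pow_eq_0_imp_const[of "Suc j" f x y] assms by auto
    qed
    then have "ip (\<Delta> ?g) ?g < 0" using laplacian_nonpos[of ?g] by simp
    moreover have "ip ((\<Delta> ^^ m) f) f = ip (\<Delta> ?g) ?g"
      unfolding j pow_add by simp
    ultimately show ?thesis using False by simp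
  qed
qed

lemma laplacian_pow_mean_field_solution:
  assumes "V \<noteq> {}" "c < 0" "m > 0" and h: "\<And>x. x \<in> V \<Longrightarrow> h x < 0"
  shows "\<exists>u. \<forall>x\<in>V. (\<Delta> ^^ m) u x = c - h x * exp (u x)"
proof -
  obtain p where p: "p \<in> V" using assms(1) by blast
  have "\<exists>u. \<forall>x\<in>V. (\<Delta> ^^ m) u x = (- h x) * exp (u x) - (- c)"
  proof (rule symmetric_mean_field_solution[where \<mu> = \<mu> and s = "(-1) ^ m" and p = p])
    show "(-1) ^ m * (-1) ^ m = (1::real)"
      by (simp add: power_mult_distrib[symmetric])
    show "(\<Sum>x\<in>V. \<mu> x * (\<Delta> ^^ m) f x * g x) = (\<Sum>x\<in>V. \<mu> x * f x * (\<Delta> ^^ m) g x)" for f g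
      using laplacian_pow_symmetric[of m f g] by (simp add: ip_def)
    show "(-1) ^ m * (\<Sum>x\<in>V. \<mu> x * (\<Delta> ^^ m) v x * v x) > 0"
      if "x \<in> V" "v x \<noteq> v p" for v x
      using laplacian_pow_definite[OF that(1) p that(2), of m] by (simp add: ip_def)
  qed (use assms p h finite_vertices measure_pos in
      \<open>auto simp: laplacian_pow_continuous laplacian_pow_linear laplacian_pow_const\<close>)
  then show ?thesis by simp
qed

end

section \<open>Connected components and gluing of solutions\<close>

context finite_weighted_graph
begin

definition component where
  "component x = {y. (x, y) \<in> {(x, y). {x, y} \<in> E}\<^sup>*}"

lemma component_closed: "y \<in> component x \<Longrightarrow> {y, z} \<in> E \<Longrightarrow> z \<in> component x"
  unfolding component_def by (auto intro: rtrancl_into_rtrancl)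

lemma component_subset: "x \<in> V \<Longrightarrow> component x \<subseteq> V"
  unfolding component_def by (auto elim: rtrancl_induct intro: edge_in)

text \<open>Reachability is symmetric because edges are unordered, so components are equivalence
  classes.\<close>

lemma component_eq:
  assumes "y \<in> component x"
  shows "component y = component x"
proof -
  have "sym ({(x, y). {x, y} \<in> E}\<^sup>*)"
    by (intro sym_rtrancl) (auto simp: sym_def insert_commute)
  then show ?thesis
    using assms unfolding component_def by (auto dest: symD intro: rtrancl_trans)
qed

text \<open>An edge-invariant function is constant along walks from \<open>x\<close>. Edges are
  restricted to the component because the locale requires their endpoints to be vertices.\<close>

lemma component_connected_weighted_graph:
  assumes "x \<in> V"
  shows "connected_weighted_graph (component x) {e \<in> E. e \<subseteq> component x} w \<mu>"
proof
  show "finite (component x)"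
    using finite_vertices component_subset[OF assms] by (rule rev_finite_subset)
  show "\<exists>y\<in>component x. \<exists>z\<in>component x. e = {y, z}" if "e \<in> {e \<in> E. e \<subseteq> component x}" for e
    using that edges by fastforce
  show "w y z = w z y" "w y z > 0" if "{y, z} \<in> {e \<in> E. e \<subseteq> component x}" for y z
    using that weight_sym weight_pos by auto
  show "\<mu> y > 0" if "y \<in> component x" for y
    using that measure_pos component_subset[OF assms] by blast
  fix f :: "'a \<Rightarrow> real" and y z
  assume inv: "\<And>y z. {y, z} \<in> {e \<in> E. e \<subseteq> component x} \<Longrightarrow> f y = f z"
  have "f y = f x" if "y \<in> component x" for y
    using that unfolding component_def mem_Collect_eq
  proof (induction rule: rtrancl_induct)
    case (step y z)
    then have "y \<in> component x" "{y, z} \<in> E" by (auto simp: component_def)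
    then have "f y = f z" using component_closed inv by simp
    then show ?case using step.IH by simp
  qed simp
  then show "f y = f z" if "y \<in> component x" "z \<in> component x"
    using that by metis
qed

end

theorem theorem13:
  fixes V :: "'a set" and E :: "'a set set"
    and w :: "'a \<Rightarrow> 'a \<Rightarrow> real" and \<mu> :: "'a \<Rightarrow> real"
    and c :: real and m :: nat and h :: "'a \<Rightarrow> real"
  assumes "finite_weighted_graph V E w \<mu>"
    and "c < 0"
    and "m > 0"
    and "\<And>x. x \<in> V \<Longrightarrow> h x < 0"
  shows "\<exists>u :: 'a \<Rightarrow> real. \<forall>x\<in>V. (laplacian E w \<mu> ^^ m) u x = c - h x * exp (u x)"
proof -
  interpret finite_weighted_graph V E w \<mu> by fact
  define sol where "sol C u \<longleftrightarrow>
    (\<forall>x\<in>C. (laplacian {e \<in> E. e \<subseteq> C} w \<mu> ^^ m) u x = c - h x * exp (u x))" for C u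
  have ex: "\<exists>u. sol (component x) u" if x: "x \<in> V" for x
  proof -
    interpret C: connected_weighted_graph "component x" "{e \<in> E. e \<subseteq> component x}" w \<mu>
      using x by (rule component_connected_weighted_graph)
    have "component x \<noteq> {}" by (auto simp: component_def)
    then show ?thesis
      unfolding sol_def using assms component_subset[OF x]
      by (intro C.laplacian_pow_mean_field_solution) auto
  qed
  \<comment> \<open>The choice depends on the component as a set, so all its vertices share one
    solution.\<close>
  define U where "U C = (SOME u. sol C u)" for C
  define u where "u x = U (component x) x" for x
  have "(\<Delta> ^^ m) u x = c - h x * exp (u x)" if x: "x \<in> V" for x
  proof -
    let ?C = "component x"
    have xC: "x \<in> ?C" by (simp add: component_def)
    have "sol ?C (U ?C)" unfolding U_def using ex[OF x] by (rule someI_ex)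
    \<comment> \<open>On the component, \<open>u\<close> agrees with the chosen solution and the
      whole graph has the same edges as the subgraph.\<close>
    moreover have "(\<Delta> ^^ m) u x = (laplacian {e \<in> E. e \<subseteq> ?C} w \<mu> ^^ m) (U ?C) x"
      using xC by (rule laplacian_pow_cong[rotated 3])
        (auto simp: u_def component_eq intro: component_closed)
    ultimately show ?thesis using xC by (simp add: sol_def u_def)
  qed
  then show ?thesis by blast
qed

end
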